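(* Let $k\in\mathbb{Z}$. The representation $\mu':L_n\longrightarrow \mathrm{GL}_n(\mathbb{Z}[t^{\pm1}])$ of the triplet group $L_n$ is reducible for all $n\ge 2$.
   Context: The triplet group $L_n$ is the group generated by $\ell_1,\ldots,\ell_{n-1}$ subject to the relations $\ell_i^2=1$ for $1\le i\le n-1$ and $\ell_i\ell_{i+1}\ell_i=\ell_{i+1}\ell_i\ell_{i+1}$ for $1\le i\le n-2$ (no commutation relations are imposed). Let $t$ be an indeterminate and $k\in\mathbb{Z}$ a fixed integer. The representation $\mu':L_n\to \mathrm{GL}_n(\mathbb{Z}[t^{\pm1}])$ ($n\ge2$) sends each generator $\ell_i$, $1\le i\le n-1$, to the block matrix \[ \begin{pmatrix} I_{i-1} & 0 & 0 \\ 0 & \begin{pmatrix} 0 & t^k \\ t^{-k} & 0 \end{pmatrix} & 0 \\ 0 & 0 & I_{n-i-1} \end{pmatrix}, \] where $I_r$ is the $r\times r$ identity matrix. Reducible means that, viewing $\mu'$ as a representation on $\mathbb{Q}(t)^n$ (column vectors) over the fraction field $\mathbb{Q}(t)$ of $\mathbb{Z}[t^{\pm1}]$, there is a nonzero proper subspace invariant under $\mu'(L_n)$. *)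

theory Defs
  imports
    "HOL-Algebra.Group"
    "HOL-Library.Poly_Mapping"
    "HOL-Computational_Algebra.Fraction_Field"
    "Jordan_Normal_Form.VS_Connect"
begin

text \<open>A letter \<open>(x, True)\<close> stands for the generator \<open>x\<close>, a letter \<open>(x, False)\<close> for its formal
  inverse. A relation \<open>p = q\<close> between words is the pair \<open>(p, q)\<close>.\<close>

type_synonym 'a gword = "('a \<times> bool) list"

abbreviation gwords :: "'a set \<Rightarrow> 'a gword set" where
  "gwords S \<equiv> lists (S \<times> UNIV)"

inductive pres_eq :: "'a set \<Rightarrow> ('a gword \<times> 'a gword) set \<Rightarrow> 'a gword \<Rightarrow> 'a gword \<Rightarrow> bool"
  for S R where
  pres_refl: "w \<in> gwords S \<Longrightarrow> pres_eq S R w w"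
| pres_sym: "pres_eq S R v w \<Longrightarrow> pres_eq S R w v"
| pres_trans: "pres_eq S R u v \<Longrightarrow> pres_eq S R v w \<Longrightarrow> pres_eq S R u w"
| pres_cancel: "x \<in> S \<Longrightarrow> u \<in> gwords S \<Longrightarrow> v \<in> gwords S \<Longrightarrow>
    pres_eq S R (u @ [(x, b), (x, \<not> b)] @ v) (u @ v)"
| pres_rel: "(p, q) \<in> R \<Longrightarrow> p \<in> gwords S \<Longrightarrow> q \<in> gwords S \<Longrightarrow> u \<in> gwords S \<Longrightarrow> v \<in> gwords S \<Longrightarrow>
    pres_eq S R (u @ p @ v) (u @ q @ v)"

definition pres_rel_set :: "'a set \<Rightarrow> ('a gword \<times> 'a gword) set \<Rightarrow> ('a gword \<times> 'a gword) set" where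
  "pres_rel_set S R = {(v, w). pres_eq S R v w}"

definition pres_class :: "'a set \<Rightarrow> ('a gword \<times> 'a gword) set \<Rightarrow> 'a gword \<Rightarrow> 'a gword set" where
  "pres_class S R w = pres_rel_set S R `` {w}"

definition presented_group :: "'a set \<Rightarrow> ('a gword \<times> 'a gword) set \<Rightarrow> 'a gword set monoid" where
  "presented_group S R =
    \<lparr>carrier = gwords S // pres_rel_set S R,
     mult = (\<lambda>X Y. \<Union>x\<in>X. \<Union>y\<in>Y. pres_class S R (x @ y)),
     one = pres_class S R []\<rparr>"

definition pres_gen :: "'a set \<Rightarrow> ('a gword \<times> 'a gword) set \<Rightarrow> 'a \<Rightarrow> 'a gword set" where
  "pres_gen S R x = pres_class S R [(x, True)]"

primrec word_value :: "('g, 'm) monoid_scheme \<Rightarrow> ('a \<Rightarrow> 'g) \<Rightarrow> 'a gword \<Rightarrow> 'g" where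
  "word_value G f [] = \<one>\<^bsub>G\<^esub>"
| "word_value G f (a # w) =
    (if snd a then f (fst a) else inv\<^bsub>G\<^esub> f (fst a)) \<otimes>\<^bsub>G\<^esub> word_value G f w"

text \<open>The homomorphism out of the presented group that extends the assignment \<open>f\<close> of the
  generators; it is well defined when \<open>f\<close> respects the relations, see \<open>pres_lift_hom\<close>,
  \<open>pres_lift_gen\<close> and \<open>pres_hom_unique\<close> below.\<close>

definition pres_lift :: "('g, 'm) monoid_scheme \<Rightarrow> ('a \<Rightarrow> 'g) \<Rightarrow> 'a gword set \<Rightarrow> 'g" where
  "pres_lift G f X = the_elem (word_value G f ` X)"

lemma pres_eq_words: "pres_eq S R v w \<Longrightarrow> v \<in> gwords S \<and> w \<in> gwords S"
  by (induction rule: pres_eq.induct) auto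

lemma pres_eq_append_left:
  "pres_eq S R v w \<Longrightarrow> u \<in> gwords S \<Longrightarrow> pres_eq S R (u @ v) (u @ w)"
proof (induction rule: pres_eq.induct)
  case (pres_cancel x u' v' b)
  then show ?case using pres_eq.pres_cancel[of x S "u @ u'" v' R b] by auto
next
  case (pres_rel p q u' v')
  then show ?case using pres_eq.pres_rel[of p q R S "u @ u'" v'] by auto
next
  case (pres_refl w)
  then show ?case by (intro pres_eq.pres_refl) simp
qed (blast intro: pres_sym pres_trans)+

lemma pres_eq_append_right:
  "pres_eq S R v w \<Longrightarrow> u \<in> gwords S \<Longrightarrow> pres_eq S R (v @ u) (w @ u)"
proof (induction rule: pres_eq.induct)
  case (pres_cancel x u' v' b)
  then show ?case using pres_eq.pres_cancel[of x S u' "v' @ u" R b] by auto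
next
  case (pres_rel p q u' v')
  then show ?case using pres_eq.pres_rel[of p q R S u' "v' @ u"] by auto
next
  case (pres_refl w)
  then show ?case by (intro pres_eq.pres_refl) simp
qed (blast intro: pres_sym pres_trans)+

lemma pres_eq_append:
  "pres_eq S R v w \<Longrightarrow> pres_eq S R v' w' \<Longrightarrow> pres_eq S R (v @ v') (w @ w')"
  by (meson pres_eq_append_left pres_eq_append_right pres_eq_words pres_trans)

lemma equiv_pres: "equiv (gwords S) (pres_rel_set S R)"
  unfolding pres_rel_set_def
  by (intro equivI refl_onI symI transI)
    (auto intro: pres_refl pres_sym pres_trans dest: pres_eq_words)

lemma in_pres_class: "v \<in> pres_class S R w \<longleftrightarrow> pres_eq S R w v"
  by (auto simp: pres_class_def pres_rel_set_def)

lemma pres_class_eqI: "pres_eq S R v w \<Longrightarrow> pres_class S R v = pres_class S R w"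
  unfolding set_eq_iff in_pres_class by (blast intro: pres_sym pres_trans)

lemma presented_group_carrier:
  "carrier (presented_group S R) = pres_class S R ` gwords S"
  by (auto simp: presented_group_def quotient_def pres_class_def)

lemma presented_group_one: "\<one>\<^bsub>presented_group S R\<^esub> = pres_class S R []"
  by (simp add: presented_group_def)

lemma presented_group_mult:
  assumes "v \<in> gwords S" "w \<in> gwords S"
  shows "pres_class S R v \<otimes>\<^bsub>presented_group S R\<^esub> pres_class S R w = pres_class S R (v @ w)"
proof -
  have eq: "pres_class S R (x @ y) = pres_class S R (v @ w)"
    if "x \<in> pres_class S R v" "y \<in> pres_class S R w" for x y
    using that by (metis in_pres_class pres_class_eqI pres_eq_append)
  have "v \<in> pres_class S R v" "w \<in> pres_class S R w"
    using assms by (simp_all only: in_pres_class pres_refl)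
  then have "(\<Union>x\<in>pres_class S R v. \<Union>y\<in>pres_class S R w. pres_class S R (x @ y)) =
      pres_class S R (v @ w)"
    using eq by blast
  then show ?thesis by (simp add: presented_group_def)
qed

lemma pres_left_inverse:
  "w \<in> gwords S \<Longrightarrow> \<exists>v\<in>gwords S. pres_eq S R (v @ w) []"
proof (induction w)
  case Nil
  then show ?case by (auto intro!: bexI[of _ "[]"] pres_refl)
next
  case (Cons a w)
  obtain x b where a: "a = (x, b)" by (cases a)
  from Cons obtain v where v: "v \<in> gwords S" "pres_eq S R (v @ w) []" by auto
  have "pres_eq S R ((v @ [(x, \<not> b)]) @ a # w) (v @ w)"
    using pres_cancel[of x S v w R "\<not> b"] Cons.prems v a by auto
  then show ?case using v Cons.prems a
    by (intro bexI[of _ "v @ [(x, \<not> b)]"]) (auto intro: pres_trans)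
qed

lemma group_presented_group: "group (presented_group S R)"
proof (rule groupI)
  show "\<one>\<^bsub>presented_group S R\<^esub> \<in> carrier (presented_group S R)"
    unfolding presented_group_one presented_group_carrier by (rule imageI) simp
next
  fix X assume "X \<in> carrier (presented_group S R)"
  then obtain w where w: "w \<in> gwords S" "X = pres_class S R w"
    by (auto simp: presented_group_carrier)
  show "\<one>\<^bsub>presented_group S R\<^esub> \<otimes>\<^bsub>presented_group S R\<^esub> X = X"
    using w presented_group_mult[of "[]" S w R] by (simp add: presented_group_one)
  obtain v where v: "v \<in> gwords S" "pres_eq S R (v @ w) []"
    using pres_left_inverse[OF w(1)] by blast
  have "pres_class S R v \<otimes>\<^bsub>presented_group S R\<^esub> X = \<one>\<^bsub>presented_group S R\<^esub>"
    using w v presented_group_mult[of v S w R] pres_class_eqI[OF v(2)]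
    by (simp add: presented_group_one)
  then show "\<exists>Y\<in>carrier (presented_group S R).
      Y \<otimes>\<^bsub>presented_group S R\<^esub> X = \<one>\<^bsub>presented_group S R\<^esub>"
    using v(1) unfolding presented_group_carrier by blast
next
  fix X Y assume "X \<in> carrier (presented_group S R)" "Y \<in> carrier (presented_group S R)"
  then obtain v w where vw: "v \<in> gwords S" "w \<in> gwords S"
    "X = pres_class S R v" "Y = pres_class S R w"
    by (auto simp only: presented_group_carrier)
  then have "v @ w \<in> gwords S" by simp
  then show "X \<otimes>\<^bsub>presented_group S R\<^esub> Y \<in> carrier (presented_group S R)"
    unfolding vw(3,4) presented_group_mult[OF vw(1,2)] presented_group_carrier by (rule imageI)
next
  fix X Y Z
  assume "X \<in> carrier (presented_group S R)" "Y \<in> carrier (presented_group S R)"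
    "Z \<in> carrier (presented_group S R)"
  then obtain u v w where g: "u \<in> gwords S" "v \<in> gwords S" "w \<in> gwords S"
    and XYZ: "X = pres_class S R u" "Y = pres_class S R v" "Z = pres_class S R w"
    by (auto simp only: presented_group_carrier)
  have uv: "u @ v \<in> gwords S" and vw: "v @ w \<in> gwords S" using g by simp_all
  show "X \<otimes>\<^bsub>presented_group S R\<^esub> Y \<otimes>\<^bsub>presented_group S R\<^esub> Z =
      X \<otimes>\<^bsub>presented_group S R\<^esub> (Y \<otimes>\<^bsub>presented_group S R\<^esub> Z)"
    unfolding XYZ presented_group_mult[OF g(1,2)] presented_group_mult[OF g(2,3)]
      presented_group_mult[OF uv g(3)] presented_group_mult[OF g(1) vw] append_assoc by (rule refl)
qed

lemma (in group) word_value_closed: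
  assumes f: "f \<in> S \<rightarrow> carrier G" and "w \<in> gwords S"
  shows "word_value G f w \<in> carrier G"
  using assms(2)
proof (induction w)
  case Nil
  then show ?case by simp
next
  case (Cons a w)
  then have "fst a \<in> S" "w \<in> gwords S" by auto
  moreover from this have "f (fst a) \<in> carrier G" using f by (blast dest: PiE)
  ultimately show ?case using Cons.IH by simp
qed

lemma (in group) word_value_append:
  assumes f: "f \<in> S \<rightarrow> carrier G" and "v \<in> gwords S" "w \<in> gwords S"
  shows "word_value G f (v @ w) = word_value G f v \<otimes> word_value G f w"
  using assms(2)
proof (induction v)
  case Nil
  then show ?case using word_value_closed[OF f assms(3)] by simp
next
  case (Cons a v)
  then have "fst a \<in> S" "v \<in> gwords S" by auto
  moreover from this have "f (fst a) \<in> carrier G" using f by auto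
  ultimately show ?case
    using Cons.IH word_value_closed[OF f assms(3)] word_value_closed[OF f, of v] by (simp add: m_assoc)
qed

lemma (in group) word_value_pres_eq:
  assumes f: "f \<in> S \<rightarrow> carrier G"
    and rel: "\<And>p q. (p, q) \<in> R \<Longrightarrow> word_value G f p = word_value G f q"
    and eq: "pres_eq S R v w"
  shows "word_value G f v = word_value G f w"
  using eq
proof (induction rule: pres_eq.induct)
  case (pres_cancel x u v b)
  then have x: "f x \<in> carrier G" and m: "[(x, b), (x, \<not> b)] \<in> gwords S"
    using f by auto
  have "word_value G f [(x, b), (x, \<not> b)] = \<one>"
    using x by (cases b) auto
  moreover have "[(x, b), (x, \<not> b)] @ v \<in> gwords S" using m pres_cancel by simp
  ultimately show ?case
    using pres_cancel m word_value_closed[OF f]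
    by (simp only: word_value_append[OF f] l_one)
next
  case (pres_rel p q u v)
  moreover from this have "p @ v \<in> gwords S" "q @ v \<in> gwords S" by simp_all
  ultimately show ?case using rel by (simp only: word_value_append[OF f])
qed simp_all

lemma (in group) pres_lift_class:
  assumes f: "f \<in> S \<rightarrow> carrier G"
    and rel: "\<And>p q. (p, q) \<in> R \<Longrightarrow> word_value G f p = word_value G f q"
    and w: "w \<in> gwords S"
  shows "pres_lift G f (pres_class S R w) = word_value G f w"
proof -
  have "word_value G f v = word_value G f w" if "v \<in> pres_class S R w" for v
    using word_value_pres_eq[OF f rel] that by (metis in_pres_class)
  moreover have "w \<in> pres_class S R w" using w by (simp add: in_pres_class pres_refl)
  ultimately have "word_value G f ` pres_class S R w = {word_value G f w}" by blast
  then show ?thesis by (simp add: pres_lift_def)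
qed

lemma (in group) pres_lift_hom:
  assumes f: "f \<in> S \<rightarrow> carrier G"
    and rel: "\<And>p q. (p, q) \<in> R \<Longrightarrow> word_value G f p = word_value G f q"
  shows "pres_lift G f \<in> hom (presented_group S R) G"
proof (rule homI)
  fix X assume "X \<in> carrier (presented_group S R)"
  then obtain w where "w \<in> gwords S" "X = pres_class S R w"
    by (auto simp only: presented_group_carrier)
  then show "pres_lift G f X \<in> carrier G"
    by (simp only: pres_lift_class[OF f rel] word_value_closed[OF f])
next
  fix X Y assume "X \<in> carrier (presented_group S R)" "Y \<in> carrier (presented_group S R)"
  then obtain v w where "v \<in> gwords S" "w \<in> gwords S"
    "X = pres_class S R v" "Y = pres_class S R w"
    by (auto simp only: presented_group_carrier)
  moreover from this have "v @ w \<in> gwords S" by simp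
  ultimately show "pres_lift G f (X \<otimes>\<^bsub>presented_group S R\<^esub> Y) = pres_lift G f X \<otimes> pres_lift G f Y"
    by (simp only: presented_group_mult pres_lift_class[OF f rel] word_value_append[OF f])
qed

lemma (in group) pres_lift_gen:
  assumes f: "f \<in> S \<rightarrow> carrier G"
    and rel: "\<And>p q. (p, q) \<in> R \<Longrightarrow> word_value G f p = word_value G f q"
    and x: "x \<in> S"
  shows "pres_lift G f (pres_gen S R x) = f x"
proof -
  have "f x \<in> carrier G" using f x by auto
  then show ?thesis
    using pres_lift_class[OF f rel, where w = "[(x, True)]"] x by (simp add: pres_gen_def)
qed

lemma (in group) pres_hom_unique:
  assumes h: "h \<in> hom (presented_group S R) G"
    and h': "h' \<in> hom (presented_group S R) G"
    and gen: "\<And>x. x \<in> S \<Longrightarrow> h (pres_gen S R x) = h' (pres_gen S R x)"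
    and X: "X \<in> carrier (presented_group S R)"
  shows "h X = h' X"
proof -
  let ?P = "presented_group S R"
  have P: "group ?P" by (rule group_presented_group)
  have hone: "h \<one>\<^bsub>?P\<^esub> = \<one>" "h' \<one>\<^bsub>?P\<^esub> = \<one>"
    using h h' P by (auto intro: hom_one simp: is_group)
  have letter: "h (pres_class S R [(x, b)]) = h' (pres_class S R [(x, b)])" if x: "x \<in> S" for x b
  proof (cases b)
    case True
    then show ?thesis using gen[OF x] by (simp add: pres_gen_def)
  next
    case False
    have gw: "[(x, True)] \<in> gwords S" "[(x, False)] \<in> gwords S" using x by auto
    have c: "pres_gen S R x \<in> carrier ?P" "pres_class S R [(x, False)] \<in> carrier ?P"
      unfolding pres_gen_def presented_group_carrier using gw by (blast intro: imageI)+
    have "pres_eq S R [(x, False), (x, True)] []"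
      using pres_cancel[of x S "[]" "[]" R False] x by simp
    then have "pres_class S R [(x, False)] \<otimes>\<^bsub>?P\<^esub> pres_gen S R x = \<one>\<^bsub>?P\<^esub>"
      unfolding pres_gen_def presented_group_mult[OF gw(2,1)] presented_group_one
      by (simp add: pres_class_eqI)
    then have "h (pres_class S R [(x, False)]) \<otimes> h (pres_gen S R x) = \<one>"
      "h' (pres_class S R [(x, False)]) \<otimes> h' (pres_gen S R x) = \<one>"
      using c hone hom_mult[OF h] hom_mult[OF h'] by metis+
    then show ?thesis
      using False gen[OF x] c hom_in_carrier[OF h] hom_in_carrier[OF h'] by (metis inv_equality inv_inv)
  qed
  obtain w where w: "w \<in> gwords S" "X = pres_class S R w"
    using X by (auto simp only: presented_group_carrier)
  have "h (pres_class S R w) = h' (pres_class S R w)"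
    using w(1)
  proof (induction w)
    case Nil
    then show ?case using hone by (simp add: presented_group_one)
  next
    case (Cons a w)
    obtain x b where a: "a = (x, b)" by (cases a)
    have gw: "[(x, b)] \<in> gwords S" "w \<in> gwords S" and x: "x \<in> S" using Cons.hyps a by auto
    have c: "pres_class S R [(x, b)] \<in> carrier ?P" "pres_class S R w \<in> carrier ?P"
      unfolding presented_group_carrier using gw by (blast intro: imageI)+
    have "pres_class S R (a # w) = pres_class S R [(x, b)] \<otimes>\<^bsub>?P\<^esub> pres_class S R w"
      unfolding presented_group_mult[OF gw] by (simp add: a)
    then show ?case
      using Cons.IH gw(2) letter[OF x] hom_mult[OF h c] hom_mult[OF h' c] by simp
  qed
  then show ?thesis using w(2) by simp
qed

definition triplet_relations :: "nat \<Rightarrow> (nat gword \<times> nat gword) set" where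
  "triplet_relations n =
     {([(i, True), (i, True)], []) | i. 1 \<le> i \<and> i < n} \<union>
     {([(i, True), (i + 1, True), (i, True)], [(i + 1, True), (i, True), (i + 1, True)])
        | i. 1 \<le> i \<and> i + 1 < n}"

definition triplet_group :: "nat \<Rightarrow> nat gword set monoid" where
  "triplet_group n = presented_group {1..<n} (triplet_relations n)"

definition triplet_gen :: "nat \<Rightarrow> nat \<Rightarrow> nat gword set" where
  "triplet_gen n i = pres_gen {1..<n} (triplet_relations n) i"

text \<open>\<open>int \<Rightarrow>\<^sub>0 int\<close> is the group ring over the integers of the additive group of integers,
  i.e. the ring of integral Laurent polynomials, and \<open>laurent fract\<close> is its fraction field.\<close>

type_synonym laurent = "int \<Rightarrow>\<^sub>0 int"

definition t_pow :: "int \<Rightarrow> laurent" where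
  "t_pow k = Poly_Mapping.single k 1"

lemma t_pow_0: "t_pow 0 = 1"
  by (simp add: t_pow_def)

lemma t_pow_add: "t_pow (j + k) = t_pow j * t_pow k"
  by (simp add: t_pow_def mult_single)

definition GL :: "nat \<Rightarrow> 'a::comm_ring_1 mat monoid" where
  "GL n = units_of (ring_mat TYPE('a) n ())"

lemma group_GL: "group (GL n :: 'a::comm_ring_1 mat monoid)"
  unfolding GL_def by (rule monoid.units_group[OF ring.is_monoid[OF ring_mat]])

definition mu'_matrix :: "int \<Rightarrow> nat \<Rightarrow> nat \<Rightarrow> laurent mat" where
  "mu'_matrix k n i =
     diag_block_mat
       [1\<^sub>m (i - 1),
        mat_of_rows_list 2 [[0, t_pow k], [t_pow (- k), 0]],
        1\<^sub>m (n - i - 1)]"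

definition mu' :: "int \<Rightarrow> nat \<Rightarrow> nat gword set \<Rightarrow> laurent mat" where
  "mu' k n = pres_lift (GL n) (mu'_matrix k n)"

lemma mu'_matrix_carrier:
  "1 \<le> i \<Longrightarrow> i < n \<Longrightarrow> mu'_matrix k n i \<in> carrier_mat n n"
  unfolding mu'_matrix_def
  by (rule carrier_matI) (simp_all add: dim_diag_block_mat mat_of_rows_list_def)

lemma diag_block_mat_middle_index:
  fixes T :: "'a::{zero,one} mat"
  assumes T: "dim_row T = 2" "dim_col T = 2" and rc: "r < p + 2 + q" "c < p + 2 + q"
  shows "diag_block_mat [1\<^sub>m p, T, 1\<^sub>m q] $$ (r, c) =
   (if p \<le> r \<and> r < p + 2 \<and> p \<le> c \<and> c < p + 2 then T $$ (r - p, c - p)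
    else if r = c then 1 else 0)"
proof -
  have 0: "diag_block_mat [1\<^sub>m q :: 'a mat] = 1\<^sub>m q" by (rule diag_block_mat_singleton)
  have e: "diag_block_mat [1\<^sub>m p, T, 1\<^sub>m q] =
    four_block_mat (1\<^sub>m p) (0\<^sub>m p (2 + q)) (0\<^sub>m (2 + q) p)
     (four_block_mat T (0\<^sub>m 2 q) (0\<^sub>m q 2) (1\<^sub>m q))"
    by (simp only: diag_block_mat.simps(2)[of _ "[_]"] diag_block_mat.simps(2)[of _ "[_,_]"]
     0 Let_def index_mat_four_block T index_one_mat)
  consider "r < p" | "p \<le> r" "r < p + 2" | "p + 2 \<le> r" by linarith
  then show ?thesis
  proof cases
    case 1
    then show ?thesis using rc T unfolding e by auto
  next
    case 2
    then show ?thesis using rc T unfolding e by auto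
  next
    case 3
    then show ?thesis using rc T unfolding e by auto
  qed
qed

lemma mu'_matrix_index:
  assumes "1 \<le> i" "i < n" "r < n" "c < n"
  shows "mu'_matrix k n i $$ (r, c) =
    (if r = i - 1 then if c = i then t_pow k else 0
     else if r = i then if c = i - 1 then t_pow (- k) else 0
     else if r = c then 1 else 0)"
proof -
  define T where "T = mat_of_rows_list 2 [[0, t_pow k], [t_pow (- k), 0]]"
  have T: "dim_row T = 2" "dim_col T = 2" "T $$ (0, 0) = 0" "T $$ (0, Suc 0) = t_pow k"
    "T $$ (Suc 0, 0) = t_pow (- k)" "T $$ (Suc 0, Suc 0) = 0"
    by (simp_all add: T_def mat_of_rows_list_def)
  obtain p where p: "i = Suc p" using assms(1) by (cases i) auto
  have n: "n = p + 2 + (n - i - 1)" using assms p by simp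
  have *: "mu'_matrix k n i $$ (r, c) =
    (if p \<le> r \<and> r < p + 2 \<and> p \<le> c \<and> c < p + 2 then T $$ (r - p, c - p)
     else if r = c then 1 else 0)"
    unfolding mu'_matrix_def T_def[symmetric] p diff_Suc_1
    using T(1,2) assms(3,4) n p by (intro diag_block_mat_middle_index) simp_all
  consider "r = p" | "r = Suc p" | "r \<noteq> p" "r \<noteq> Suc p" by blast
  then show ?thesis
  proof cases
    case 1
    then show ?thesis unfolding * using p T by (cases "c = p"; cases "c = Suc p") auto
  next
    case 2
    then show ?thesis unfolding * using p T by (cases "c = p"; cases "c = Suc p") auto
  next
    case 3
    then show ?thesis unfolding * using p by auto
  qed
qed

lemma mu'_matrix_mult_index:
  assumes i: "1 \<le> i" "i < n" and M: "M \<in> carrier_mat n m" and rc: "r < n" "c < m"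
  shows "(mu'_matrix k n i * M) $$ (r, c) =
    (if r = i - 1 then t_pow k * M $$ (i, c)
     else if r = i then t_pow (- k) * M $$ (i - 1, c)
     else M $$ (r, c))"
proof -
  have "(mu'_matrix k n i * M) $$ (r, c) = (\<Sum>j<n. mu'_matrix k n i $$ (r, j) * M $$ (j, c))"
    using mu'_matrix_carrier[OF i, of k] M rc
    by (auto simp: scalar_prod_def lessThan_atLeast0 intro!: sum.cong)
  also have "\<dots> = (\<Sum>j<n. if j = (if r = i - 1 then i else if r = i then i - 1 else r)
      then (if r = i - 1 then t_pow k else if r = i then t_pow (- k) else 1) * M $$ (j, c) else 0)"
    using i rc by (intro sum.cong refl) (auto simp: mu'_matrix_index)
  also have "\<dots> = (if r = i - 1 then t_pow k else if r = i then t_pow (- k) else 1) *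
      M $$ (if r = i - 1 then i else if r = i then i - 1 else r, c)"
    using i rc by (subst sum.delta) auto
  finally show ?thesis by simp
qed

lemma mu'_matrix_square:
  assumes i: "1 \<le> i" "i < n"
  shows "mu'_matrix k n i * mu'_matrix k n i = 1\<^sub>m n"
proof (rule eq_matI)
  fix r c assume "r < dim_row (1\<^sub>m n :: laurent mat)" "c < dim_col (1\<^sub>m n :: laurent mat)"
  then show "(mu'_matrix k n i * mu'_matrix k n i) $$ (r, c) = 1\<^sub>m n $$ (r, c)"
    using i mu'_matrix_carrier[OF i, of k]
    by (subst mu'_matrix_mult_index[where n = n and m = n])
      (auto simp: mu'_matrix_index t_pow_add[symmetric] t_pow_0)
qed (use mu'_matrix_carrier[OF i, of k] in auto)

lemma mu'_matrix_braid:
  fixes k :: int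
  assumes i: "1 \<le> i" "i + 1 < n"
  defines "A \<equiv> mu'_matrix k n i" and "B \<equiv> mu'_matrix k n (i + 1)"
  shows "A * (B * A) = B * (A * B)"
proof -
  have A: "A \<in> carrier_mat n n" and B: "B \<in> carrier_mat n n"
    unfolding A_def B_def using i by (auto intro!: mu'_matrix_carrier)
  then have AB: "A * B \<in> carrier_mat n n" and BA: "B * A \<in> carrier_mat n n" by auto
  have iA: "\<And>M r c. M \<in> carrier_mat n n \<Longrightarrow> r < n \<Longrightarrow> c < n \<Longrightarrow> (A * M) $$ (r, c) =
    (if r = i - 1 then t_pow k * M $$ (i, c)
     else if r = i then t_pow (- k) * M $$ (i - 1, c) else M $$ (r, c))"
    unfolding A_def using i by (intro mu'_matrix_mult_index) auto
  have iB: "\<And>M r c. M \<in> carrier_mat n n \<Longrightarrow> r < n \<Longrightarrow> c < n \<Longrightarrow> (B * M) $$ (r, c) =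
    (if r = i then t_pow k * M $$ (i + 1, c)
     else if r = i + 1 then t_pow (- k) * M $$ (i, c) else M $$ (r, c))"
    unfolding B_def using i mu'_matrix_mult_index[of "i + 1" n _ n] by simp
  have eA: "\<And>r c. r < n \<Longrightarrow> c < n \<Longrightarrow> A $$ (r, c) =
    (if r = i - 1 then if c = i then t_pow k else 0
     else if r = i then if c = i - 1 then t_pow (- k) else 0
     else if r = c then 1 else 0)"
    unfolding A_def using i by (intro mu'_matrix_index) auto
  have eB: "\<And>r c. r < n \<Longrightarrow> c < n \<Longrightarrow> B $$ (r, c) =
    (if r = i then if c = i + 1 then t_pow k else 0
     else if r = i + 1 then if c = i then t_pow (- k) else 0
     else if r = c then 1 else 0)"
    unfolding B_def using i mu'_matrix_index[of "i + 1" n] by simp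
  show ?thesis
  proof (rule eq_matI)
    fix r c assume "r < dim_row (B * (A * B))" "c < dim_col (B * (A * B))"
    then have rc: "r < n" "c < n" using A B by auto
    have bounds: "i - 1 < n" "i < n" "i + 1 < n" "i - 1 \<noteq> i" "i - 1 \<noteq> i + 1" "i \<noteq> i - 1"
      "i + 1 \<noteq> i - 1" using i by auto
    consider "r = i - 1" | "r = i" | "r = i + 1" | "r \<noteq> i - 1" "r \<noteq> i" "r \<noteq> i + 1" by blast
    then show "(A * (B * A)) $$ (r, c) = (B * (A * B)) $$ (r, c)"
      by cases (use rc bounds in
        \<open>simp_all add: iA[OF BA] iB[OF AB] iA[OF B] iB[OF A] eA eB t_pow_add[symmetric] t_pow_0 mult.commute\<close>)
  qed (use A B in auto)
qed

lemma mu'_matrix_GL: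
  "mu'_matrix k n \<in> {1..<n} \<rightarrow> carrier (GL n)"
proof
  fix i assume "i \<in> {1..<n}"
  then have "mu'_matrix k n i \<in> carrier_mat n n" "mu'_matrix k n i * mu'_matrix k n i = 1\<^sub>m n"
    by (auto simp: mu'_matrix_carrier mu'_matrix_square)
  then show "mu'_matrix k n i \<in> carrier (GL n)"
    by (auto simp: GL_def units_of_carrier Units_def ring_mat_simps)
qed

lemma mu'_matrix_relations:
  assumes "(p, q) \<in> triplet_relations n"
  shows "word_value (GL n) (mu'_matrix k n) p = word_value (GL n) (mu'_matrix k n) q"
proof -
  have c: "1 \<le> i \<Longrightarrow> i < n \<Longrightarrow> mu'_matrix k n i * 1\<^sub>m n = mu'_matrix k n i" for i
    by (rule right_mult_one_mat[OF mu'_matrix_carrier])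
  have s: "one (GL n) = (1\<^sub>m n :: laurent mat)" "mult (GL n) = ((*) :: laurent mat \<Rightarrow> _)"
    by (simp_all add: GL_def units_of_one units_of_mult ring_mat_simps)
  show ?thesis
    using assms mu'_matrix_square[of _ n k] mu'_matrix_braid[of _ n k]
    by (auto simp: triplet_relations_def s c)
qed

theorem group_triplet_group: "group (triplet_group n)"
  unfolding triplet_group_def by (rule group_presented_group)

theorem mu'_hom: "mu' k n \<in> hom (triplet_group n) (GL n)"
  unfolding mu'_def triplet_group_def
  by (intro group.pres_lift_hom group_GL mu'_matrix_GL mu'_matrix_relations)

theorem mu'_gen:
  "1 \<le> i \<Longrightarrow> i < n \<Longrightarrow> mu' k n (triplet_gen n i) = mu'_matrix k n i"
  unfolding mu'_def triplet_gen_def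
  by (intro group.pres_lift_gen group_GL mu'_matrix_GL mu'_matrix_relations) auto

definition reducible_over_field ::
  "nat \<Rightarrow> ('g, 'm) monoid_scheme \<Rightarrow> ('g \<Rightarrow> 'a::field mat) \<Rightarrow> bool" where
  "reducible_over_field n G \<rho> \<longleftrightarrow>
     (\<exists>W. VectorSpace.subspace class_ring W (module_vec TYPE('a) n) \<and>
          W \<noteq> {0\<^sub>v n} \<and> W \<noteq> carrier_vec n \<and>
          (\<forall>g\<in>carrier G. \<forall>w\<in>W. \<rho> g *\<^sub>v w \<in> W))"

text \<open>For an integral domain, reducibility is tested on the column space over the fraction field.\<close>

definition reducible_rep ::
  "nat \<Rightarrow> ('g, 'm) monoid_scheme \<Rightarrow> ('g \<Rightarrow> 'a::idom mat) \<Rightarrow> bool" where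
  "reducible_rep n G \<rho> \<longleftrightarrow>
     reducible_over_field n G (\<lambda>g. map_mat (\<lambda>a. Fract a 1) (\<rho> g))"

end

theory Submission
  imports Defs
begin

text \<open>
  The column vector \<open>v = (1, t\<^sup>-\<^sup>k, t\<^sup>-\<^sup>2\<^sup>k, \<dots>)\<close> is a common fixed vector of all generators. Indeed the
  \<open>i\<close>-th generator replaces the consecutive entries \<open>(x, y)\<close> in the \<open>i\<close>-th and \<open>(i + 1)\<close>-th place by
  \<open>(t\<^sup>k y, t\<^sup>-\<^sup>k x)\<close>, so it fixes exactly those vectors with \<open>y = t\<^sup>-\<^sup>k x\<close> there; the factor is the
  same for every \<open>i\<close>, and the geometric progression with ratio \<open>t\<^sup>-\<^sup>k\<close> meets all conditions at once.
  A vector fixed by the generators is fixed by the whole group (\<open>word_value_GL_fixes\<close>), so the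
  line spanned by \<open>v\<close> over the fraction field is invariant. It is nonzero, and for \<open>n \<ge> 2\<close> a
  line is a proper subspace (\<open>fixed_vector_reducible\<close>).
\<close>

lemma fixed_vector_reducible:
  fixes \<rho> :: "'g \<Rightarrow> 'a::field mat"
  assumes n: "2 \<le> n"
    and v: "v \<in> carrier_vec n" "v \<noteq> 0\<^sub>v n"
    and \<rho>: "\<And>g. g \<in> carrier G \<Longrightarrow> \<rho> g \<in> carrier_mat n n"
    and fixes_v: "\<And>g. g \<in> carrier G \<Longrightarrow> \<rho> g *\<^sub>v v = v"
  shows "reducible_over_field n G \<rho>"
proof -
  define W where "W = range (\<lambda>a. a \<cdot>\<^sub>v v)"
  have "submodule class_ring W (module_vec TYPE('a) n)"
  proof (rule submodule.intro[OF vec_module], unfold module_vec_simps)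
    show "W \<subseteq> carrier_vec n" using v by (auto simp: W_def)
    show "0\<^sub>v n \<in> W" using v by (auto simp: W_def intro!: image_eqI[of _ _ 0])
  next
    fix x y assume "x \<in> W" "y \<in> W"
    then show "x + y \<in> W" by (auto simp: W_def add_smult_distrib_vec[symmetric])
  next
    fix c :: 'a and x assume "x \<in> W"
    then show "c \<cdot>\<^sub>v x \<in> W" by (auto simp: W_def smult_smult_assoc)
  qed
  then have "VectorSpace.subspace class_ring W (module_vec TYPE('a) n)"
    by (intro VectorSpace.subspace.intro vec_vs)
  moreover have "v \<in> W" by (auto simp: W_def intro!: image_eqI[of _ _ 1])
  then have "W \<noteq> {0\<^sub>v n}" using v by auto
  moreover have "W \<noteq> carrier_vec n"
  proof
    \<comment> \<open>If both of the first two unit vectors were multiples of \<open>v\<close>, the entry \<open>v $ 1\<close>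
      would have to be zero (from the first) and nonzero (from the second).\<close>
    assume "W = carrier_vec n"
    then have "unit_vec n 0 \<in> W" "unit_vec n 1 \<in> W" by auto
    then obtain a b where ab: "unit_vec n 0 = a \<cdot>\<^sub>v v" "unit_vec n 1 = b \<cdot>\<^sub>v v"
      by (auto simp: W_def)
    have "(unit_vec n 0 :: 'a vec) $ 0 = 1" "(unit_vec n 0 :: 'a vec) $ 1 = 0"
      "(unit_vec n 1 :: 'a vec) $ 1 = 1" using n by simp_all
    then have "a * v $ 0 = 1" "a * v $ 1 = 0" "b * v $ 1 = 1"
      unfolding ab using n v by simp_all
    then show False by auto
  qed
  moreover have "\<rho> g *\<^sub>v w \<in> W" if "g \<in> carrier G" "w \<in> W" for g w
    using that mult_mat_vec[OF \<rho> v(1)] fixes_v by (auto simp: W_def)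
  ultimately show ?thesis unfolding reducible_over_field_def by blast
qed

lemma semiring_hom_Fract: "semiring_hom (\<lambda>a :: 'a::idom. Fract a 1)"
  by unfold_locales (simp_all add: fract_expand)

text \<open>An integral fixed vector stays a nonzero fixed vector over the fraction field, because an
  integral domain embeds into it.\<close>

lemma fixed_vector_reducible_rep:
  fixes \<rho> :: "'g \<Rightarrow> 'a::idom mat"
  assumes n: "2 \<le> n"
    and v: "v \<in> carrier_vec n" "v \<noteq> 0\<^sub>v n"
    and \<rho>: "\<And>g. g \<in> carrier G \<Longrightarrow> \<rho> g \<in> carrier_mat n n"
    and fixes_v: "\<And>g. g \<in> carrier G \<Longrightarrow> \<rho> g *\<^sub>v v = v"
  shows "reducible_rep n G \<rho>"
  unfolding reducible_rep_def
proof (rule fixed_vector_reducible[OF n])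
  let ?v = "map_vec (\<lambda>a. Fract a 1) v"
  show "?v \<in> carrier_vec n" using v by simp
  obtain j where j: "j < n" "v $ j \<noteq> 0"
    using v by (metis carrier_vecD eq_vecI index_zero_vec)
  then have "?v $ j \<noteq> 0" using v by (simp add: fract_expand eq_fract)
  then show "?v \<noteq> 0\<^sub>v n" using j by auto
  fix g assume g: "g \<in> carrier G"
  show "map_mat (\<lambda>a. Fract a 1) (\<rho> g) \<in> carrier_mat n n" using \<rho>[OF g] by simp
  show "map_mat (\<lambda>a. Fract a 1) (\<rho> g) *\<^sub>v ?v = ?v"
    using semiring_hom.mult_mat_vec_hom[OF semiring_hom_Fract \<rho>[OF g] v(1)] fixes_v[OF g] by simp
qed

lemma GL_carrier_mat: "A \<in> carrier (GL n) \<Longrightarrow> A \<in> carrier_mat n n"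
  by (auto simp: GL_def units_of_carrier Units_def ring_mat_simps)

lemma GL_simps:
  "\<one>\<^bsub>GL n\<^esub> = 1\<^sub>m n" "A \<otimes>\<^bsub>GL n\<^esub> B = A * B"
  by (simp_all add: GL_def units_of_one units_of_mult ring_mat_simps)

lemma GL_inv_fixes:
  assumes A: "A \<in> carrier (GL n)" and v: "v \<in> carrier_vec n" and fixes_v: "A *\<^sub>v v = v"
  shows "inv\<^bsub>GL n\<^esub> A *\<^sub>v v = v"
proof -
  let ?B = "inv\<^bsub>GL n\<^esub> A"
  have B: "?B \<in> carrier_mat n n"
    using group.inv_closed[OF group_GL A] by (rule GL_carrier_mat)
  have "?B *\<^sub>v v = ?B *\<^sub>v (A *\<^sub>v v)" by (simp add: fixes_v)
  also have "\<dots> = (?B * A) *\<^sub>v v"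
    using assoc_mult_mat_vec[OF B GL_carrier_mat[OF A] v] by simp
  also have "?B * A = 1\<^sub>m n"
    using group.l_inv[OF group_GL A] by (simp only: GL_simps)
  finally show ?thesis using v by simp
qed

text \<open>The stabiliser of \<open>v\<close> in \<open>GL n\<close> is a subgroup, so it contains the value of every word,
  inverse letters included, as soon as it contains the values of the generators.\<close>

lemma word_value_GL_fixes:
  assumes f: "f \<in> S \<rightarrow> carrier (GL n)" and v: "v \<in> carrier_vec n"
    and fixes_v: "\<And>x. x \<in> S \<Longrightarrow> f x *\<^sub>v v = v" and w: "w \<in> gwords S"
  shows "word_value (GL n) f w *\<^sub>v v = v"
  using w
proof (induction w)
  case Nil
  then show ?case using v by (simp add: GL_simps)
next
  case (Cons a w)
  define A where "A = (if snd a then f (fst a) else inv\<^bsub>GL n\<^esub> f (fst a))"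
  define B where "B = word_value (GL n) f w"
  have a: "fst a \<in> S" and w: "w \<in> gwords S" using Cons.hyps by auto
  have fa: "f (fst a) \<in> carrier (GL n)" using f a by auto
  have "A *\<^sub>v v = v"
    using fixes_v[OF a] GL_inv_fixes[OF fa v] by (simp add: A_def)
  moreover have "A \<in> carrier_mat n n"
    unfolding A_def using fa group.inv_closed[OF group_GL fa] by (simp add: GL_carrier_mat)
  moreover have "B \<in> carrier_mat n n"
    unfolding B_def using group.word_value_closed[OF group_GL f w] by (rule GL_carrier_mat)
  moreover have "B *\<^sub>v v = v" unfolding B_def by (rule Cons.IH)
  ultimately have "(A * B) *\<^sub>v v = v"
    using assoc_mult_mat_vec v by metis
  then show ?case by (simp only: word_value.simps GL_simps A_def B_def)
qed

lemma mu'_matrix_mult_vec_index: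
  assumes i: "1 \<le> i" "i < n" and v: "v \<in> carrier_vec n" and r: "r < n"
  shows "(mu'_matrix k n i *\<^sub>v v) $ r =
    (if r = i - 1 then t_pow k * v $ i else if r = i then t_pow (- k) * v $ (i - 1) else v $ r)"
proof -
  \<comment> \<open>Viewing \<open>v\<close> as a one-column matrix reduces the claim to the formula for matrix products.\<close>
  have V: "mat_of_cols n [v] \<in> carrier_mat n 1" by (simp add: mat_of_cols_def)
  have "(mu'_matrix k n i *\<^sub>v v) $ r = (mu'_matrix k n i * mat_of_cols n [v]) $$ (r, 0)"
    using mu'_matrix_carrier[OF i, of k] v r by simp
  also have "\<dots> = (if r = i - 1 then t_pow k * v $ i
      else if r = i then t_pow (- k) * v $ (i - 1) else v $ r)"
    using mu'_matrix_mult_index[OF i V r, of 0 k] i r by (simp add: mat_of_cols_def)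
  finally show ?thesis .
qed

definition geometric_vec :: "int \<Rightarrow> nat \<Rightarrow> laurent vec" where
  "geometric_vec k n = vec n (\<lambda>r. t_pow (- k * int r))"

lemma mu'_matrix_fixes_geometric_vec:
  assumes i: "1 \<le> i" "i < n"
  shows "mu'_matrix k n i *\<^sub>v geometric_vec k n = geometric_vec k n"
proof (rule eq_vecI)
  fix r assume "r < dim_vec (geometric_vec k n)"
  then have r: "r < n" by (simp add: geometric_vec_def)
  obtain p where p: "i = Suc p" using i by (cases i) auto
  have v: "geometric_vec k n \<in> carrier_vec n" by (simp add: geometric_vec_def)
  show "(mu'_matrix k n i *\<^sub>v geometric_vec k n) $ r = geometric_vec k n $ r"
    unfolding mu'_matrix_mult_vec_index[OF i v r]
    using i r p by (auto simp: geometric_vec_def t_pow_add[symmetric] algebra_simps)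
qed (use mu'_matrix_carrier[OF i, of k] in \<open>simp add: geometric_vec_def\<close>)

theorem theorem17:
  fixes k :: int and n :: nat
  assumes "n \<ge> 2"
  shows "reducible_rep n (triplet_group n) (mu' k n)"
proof (rule fixed_vector_reducible_rep[OF assms])
  show v: "geometric_vec k n \<in> carrier_vec n" by (simp add: geometric_vec_def)
  have "geometric_vec k n $ 0 = 1" using assms by (simp add: geometric_vec_def t_pow_0)
  then show "geometric_vec k n \<noteq> 0\<^sub>v n" using assms by auto
  fix g assume g: "g \<in> carrier (triplet_group n)"
  show "mu' k n g \<in> carrier_mat n n"
    using hom_in_carrier[OF mu'_hom g] by (rule GL_carrier_mat)
  obtain w where w: "w \<in> gwords {1..<n}"
    and g_eq: "g = pres_class {1..<n} (triplet_relations n) w"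
    using g unfolding triplet_group_def presented_group_carrier by blast
  have "mu' k n g = word_value (GL n) (mu'_matrix k n) w"
    unfolding mu'_def g_eq
    by (rule group.pres_lift_class[OF group_GL mu'_matrix_GL mu'_matrix_relations w])
  then show "mu' k n g *\<^sub>v geometric_vec k n = geometric_vec k n"
    using word_value_GL_fixes[OF mu'_matrix_GL v mu'_matrix_fixes_geometric_vec w] by simp
qed

end
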